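(* Let $\Lambda_0\subset\mathbb{R}^n$ be an $n$-dimensional lattice of density $\beta$, used over an additive circularly-symmetric noise (ACSN) channel whose noise norm $\|z\|$ has density $f_{\|z\|}$. Then the error probability of the maximum-likelihood (nearest-lattice-point) decoder satisfies, for every $r>0$, $$P_e(\Lambda_0)\le\sum_{j=1}^{M}\mathcal{N}_j\int_{\lambda_j/2}^{r}f_{\|z\|}(\rho)\left(1-\left(\frac{\lambda_j}{2\rho}\right)^2\right)^{\frac{n-1}{2}}d\rho+\int_r^\infty f_{\|z\|}(\rho)\,d\rho,$$ where $M=M(r)$ is the largest index $j$ with $\lambda_j\le 2r$ (the sum being empty if $\lambda_1>2r$); hence $P_e(\Lambda_0)$ is at most the minimum over $r$ of the right-hand side.
   Context: An ACSN channel: the receiver observes $y=\lambda+z$, where $\lambda$ is the transmitted lattice point and $z\in\mathbb{R}^n$ is noise whose distribution is isotropic (invariant under orthogonal maps) with density a non-increasing function of $\|z\|$; $f_{\|z\|}$ is the density of $\|z\|$. The ML decoder errs when $z$ is not in the Voronoi cell $\{y:\|y\|<\|y-\lambda\|\ \forall\lambda\in\Lambda_0\setminus\{0\}\}$ of $0$; $P_e(\Lambda_0)$ is this probability. The distance series $0<\lambda_1<\lambda_2<\cdots$ lists the distinct Euclidean norms of nonzero vectors of $\Lambda_0$, and $\mathcal{N}_j=\#\{\lambda\in\Lambda_0:\|\lambda\|=\lambda_j\}$. *)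

theory Defs
  imports "HOL-Probability.Probability"
begin

text \<open>An n-dimensional (full-rank) lattice in R^n: the integer span of the columns
of an invertible n x n real matrix B.\<close>
definition is_lattice :: "(real^'n) set \<Rightarrow> bool" where
  "is_lattice L \<longleftrightarrow>
     (\<exists>B :: real^'n^'n. invertible B \<and>
        L = range (\<lambda>k :: int^'n. B *v (\<chi> i. real_of_int (k $ i))))"

text \<open>(Open) Voronoi cell of the origin.\<close>
definition voronoi0 :: "(real^'n) set \<Rightarrow> (real^'n) set" where
  "voronoi0 L = {y. \<forall>v\<in>L - {0}. norm y < norm (y - v)}"

text \<open>Distinct norms of nonzero lattice vectors.\<close>
definition lattice_norms :: "(real^'n) set \<Rightarrow> real set" where
  "lattice_norms L = {norm v | v. v \<in> L \<and> v \<noteq> 0}"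

text \<open>Distance series: lattice_dist L 1 < lattice_dist L 2 < ... lists the
distinct norms in increasing order (index 0 is an unused dummy value 0).\<close>
primrec lattice_dist :: "(real^'n) set \<Rightarrow> nat \<Rightarrow> real" where
  "lattice_dist L 0 = 0"
| "lattice_dist L (Suc j) = Inf {d \<in> lattice_norms L. d > lattice_dist L j}"

text \<open>Multiplicity N_j of the j-th distance.\<close>
definition lattice_mult :: "(real^'n) set \<Rightarrow> nat \<Rightarrow> nat" where
  "lattice_mult L j = card {v \<in> L. norm v = lattice_dist L j}"

text \<open>M(r): the largest index j \<ge> 1 with lambda_j \<le> 2r (0 if there is none).\<close>
definition lattice_M :: "(real^'n) set \<Rightarrow> real \<Rightarrow> nat" where
  "lattice_M L r = Max (insert 0 {j. 1 \<le> j \<and> lattice_dist L j \<le> 2 * r})"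

end

theory Submission
  imports Defs
begin

text \<open>
  An ML decoding error means that some nonzero lattice vector \<open>v\<close> is at least as close to the
  received point \<open>z\<close> as \<open>0\<close> is, i.e.\ \<open>z\<close> lies beyond the hyperplane at distance \<open>\<bar>v\<bar>/2\<close>
  orthogonal to \<open>v\<close>. If \<open>\<bar>z\<bar> \<le> r\<close> this forces \<open>\<bar>v\<bar> \<le> 2r\<close>, so a union bound over these finitely
  many \<open>v\<close>, plus the event \<open>\<bar>z\<bar> > r\<close>, bounds the error probability; grouping the \<open>v\<close> by their
  norms \<open>\<lambda>\<^sub>j\<close> produces the multiplicities \<open>N\<^sub>j\<close>.

  For a single half-space at distance \<open>d\<close>, look at a shell \<open>a < \<bar>x\<bar> \<le> b\<close>. Its part beyond the
  hyperplane lies in the circular cone \<open>(d/b)\<bar>x\<bar> \<le> x \<bullet> u\<close>, and the unit ball cut down to that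
  cone fits into an ellipsoid with semi-axes \<open>1\<close> and \<open>\<surd>(1 - (d/b)\<^sup>2)\<close>; hence at most the
  fraction \<open>(1 - (d/b)\<^sup>2)\<^bsup>(n-1)/2\<^esup>\<close> of the shell is beyond the hyperplane. The noise density is a
  non-increasing function of \<open>\<bar>x\<bar>\<close>, so Riemann sums over ever thinner shells turn these estimates
  into the integral of \<open>f\<^sub>\<bar>\<^sub>z\<^sub>\<bar>\<close> against that fraction.
\<close>

section \<open>Lebesgue measure of linear images\<close>

lemma measure_swap_coordinates_cbox:
  fixes a b :: "real^'n" and m n :: 'n
  defines "p \<equiv> \<lambda>x::real^'n. \<chi> i. x $ Transposition.transpose m n i"
  shows "measure lebesgue (p ` cbox a b) = \<bar>det (matrix p)\<bar> * measure lebesgue (cbox a b)"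
proof -
  have "matrix p = transpose (\<chi> i j. mat 1 $ i $ Transposition.transpose m n j)"
    by (auto simp: p_def matrix_def transpose_def axis_def mat_def vec_eq_iff)
  then have det: "\<bar>det (matrix p)\<bar> = 1"
    by (simp add: det_permute_columns permutes_swap_id sign_swap_id)
  show ?thesis
  proof (cases "cbox a b = {}")
    case False
    have eq: "p ` cbox a b = cbox (p a) (p b)"
      unfolding p_def
      by (auto simp: image_iff mem_box_cart lambda_swap_Galois) (metis transpose_involutory)+
    then have "cbox (p a) (p b) \<noteq> {}"
      using False by blast
    then have "measure lebesgue (p ` cbox a b) = measure lebesgue (cbox a b)"
      using False prod.permute [OF permutes_swap_id, where S=UNIV and g="\<lambda>i. (b - a) $ i", symmetric]
      unfolding eq by (simp add: content_cbox_cart p_def)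
    then show ?thesis
      by (simp add: det)
  qed (simp add: det)
qed

lemma measure_shear_cbox:
  fixes a b :: "real^'n" and m n :: 'n
  defines "h \<equiv> \<lambda>x::real^'n. \<chi> i. if i = m then x $ m + x $ n else x $ i"
  assumes "m \<noteq> n"
  shows "measure lebesgue (h ` cbox a b) = \<bar>det (matrix h)\<bar> * measure lebesgue (cbox a b)"
proof -
  have "matrix h = (\<chi> k. if k = m then row m (mat 1) + 1 *s row n (mat 1) else row k (mat 1))"
    using assms by (auto simp: h_def matrix_def vec_eq_iff row_def mat_def axis_def)
  then have det: "det (matrix h) = 1"
    using det_row_operation[OF \<open>m \<noteq> n\<close>, of "mat 1" 1] by simp
  show ?thesis
  proof (cases "cbox a b = {}")
    case False
    define w :: "real^'n" where "w = (\<chi> i. if i = n then a $ n else 0)"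
    have lin: "linear h"
      unfolding h_def by (rule linearI) (auto simp: vec_eq_iff algebra_simps)
    have box: "cbox a b = (+) w ` cbox (a - w) (b - w)"
      using cbox_translation[of w "a - w" "b - w"] by simp
    have "h ` cbox a b = (+) (h w) ` h ` cbox (a - w) (b - w)"
      unfolding box image_image using linear_add[OF lin] by (simp add: add.commute)
    then have "measure lebesgue (h ` cbox a b) = measure lebesgue (h ` cbox (a - w) (b - w))"
      by (simp add: measure_translation)
    also have "\<dots> = measure lebesgue (cbox (a - w) (b - w))"
      unfolding h_def using False assms by (intro measure_shear_interval) (auto simp: box w_def)
    also have "\<dots> = measure lebesgue (cbox a b)"
      by (simp add: box measure_translation)
    finally show ?thesis
      by (simp add: det)
  qed (simp add: det)
qed

text \<open>\<open>Change_Of_Vars\<close> proves this only for index types of class \<open>wellorder\<close>; the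
  argument (induction over elementary linear maps) does not need that.\<close>

lemma measure_linear_image_finite:
  fixes f :: "real^'n \<Rightarrow> real^'n"
  assumes "linear f" and "S \<in> lmeasurable"
  shows "f ` S \<in> lmeasurable \<and> measure lebesgue (f ` S) = \<bar>det (matrix f)\<bar> * measure lebesgue S"
proof -
  let ?P = "\<lambda>f::real^'n \<Rightarrow> real^'n. \<forall>S\<in>lmeasurable.
              f ` S \<in> lmeasurable \<and> measure lebesgue (f ` S) = \<bar>det (matrix f)\<bar> * measure lebesgue S"
  have from_cbox: "?P f"
    if "linear f"
      and "\<And>a b. measure lebesgue (f ` cbox a b) = \<bar>det (matrix f)\<bar> * measure lebesgue (cbox a b)"
    for f
    using measure_linear_sufficient[OF that(1) _ that(2)] by auto
  have "?P f"
  proof (rule induct_linear_elementary[OF \<open>linear f\<close>])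
    fix f g :: "real^'n \<Rightarrow> real^'n"
    assume "linear f" "linear g" and f: "?P f" and g: "?P g"
    show "?P (f \<circ> g)"
    proof
      fix S :: "(real^'n) set"
      assume "S \<in> lmeasurable"
      then show "(f \<circ> g) ` S \<in> lmeasurable \<and>
          measure lebesgue ((f \<circ> g) ` S) = \<bar>det (matrix (f \<circ> g))\<bar> * measure lebesgue S"
        using f[rule_format, of "g ` S"] g[rule_format, of S] matrix_compose[OF \<open>linear g\<close> \<open>linear f\<close>]
        by (simp add: image_comp det_mul abs_mult)
    qed
  next
    fix f :: "real^'n \<Rightarrow> real^'n" and i
    assume "linear f" and "\<And>x. f x $ i = 0"
    then have "\<not> inj f"
      by (metis linear_injective_imp_surjective one_neq_zero surjE vec_component)
    then have "det (matrix f) = 0" and "negligible (f ` S)" for S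
      using det_nz_iff_inj[OF \<open>linear f\<close>] negligible_linear_singular_image[OF \<open>linear f\<close>] by auto
    then show "?P f"
      by (simp add: negligible_imp_measure0 negligible_iff_null_sets null_sets_completion_subset
          fmeasurableI_null_sets)
  next
    fix c :: "'n \<Rightarrow> real"
    show "?P (\<lambda>x. \<chi> i. c i * x $ i)"
      by (simp add: measurable_stretch measure_stretch matrix_def axis_def det_diagonal)
  next
    fix m n :: 'n
    assume "m \<noteq> n"
    show "?P (\<lambda>x. \<chi> i. x $ Transposition.transpose m n i)"
      by (intro from_cbox measure_swap_coordinates_cbox) (auto intro!: linearI simp: vec_eq_iff)
    show "?P (\<lambda>x. \<chi> i. if i = m then x $ m + x $ n else x $ i)"
      using \<open>m \<noteq> n\<close>
      by (intro from_cbox measure_shear_cbox) (auto intro!: linearI simp: vec_eq_iff algebra_simps)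
  qed
  then show ?thesis
    using assms(2) by blast
qed

lemma measure_orthogonal_image_finite:
  fixes f :: "real^'n \<Rightarrow> real^'n"
  assumes "orthogonal_transformation f" and "S \<in> lmeasurable"
  shows "measure lebesgue (f ` S) = measure lebesgue S"
  using measure_linear_image_finite[OF orthogonal_transformation_linear[OF assms(1)] assms(2)] assms(1)
  by simp

section \<open>Circular cones and ellipsoids\<close>

definition circular_cone :: "'a::real_inner \<Rightarrow> real \<Rightarrow> 'a set" where
  "circular_cone u t = {x. t * norm x \<le> x \<bullet> u}"

definition axial_stretch :: "'a::real_inner \<Rightarrow> real \<Rightarrow> 'a \<Rightarrow> 'a" where
  "axial_stretch u l x = l *\<^sub>R x + ((1 - l) * (x \<bullet> u)) *\<^sub>R u"

lemma closed_circular_cone: "closed (circular_cone (u::'a::real_inner) t)"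
  unfolding circular_cone_def by (intro closed_Collect_le continuous_intros)

lemma lmeasurable_cball_Int_circular_cone: "cball 0 R \<inter> circular_cone (u::real^'n) t \<in> lmeasurable"
  by (intro lmeasurable_compact compact_Int_closed closed_circular_cone) auto

lemma measure_axial_stretch_cball:
  fixes u :: "real^'n"
  assumes u: "norm u = 1" and l: "0 \<le> l"
  shows "measure lebesgue (axial_stretch u l ` cball 0 1) = unit_ball_vol CARD('n) * l ^ (CARD('n) - 1)"
proof -
  obtain k :: 'n where True by blast
  obtain Q :: "real^'n \<Rightarrow> real^'n" where Q: "orthogonal_transformation Q" "Q (axis k 1) = u"
    by (metis orthogonal_transformation_exists_1 norm_axis_1 u)
  define m where "m i = (if i = k then 1 else l)" for i
  define stretch :: "real^'n \<Rightarrow> real^'n" where "stretch y = (\<chi> i. m i * y $ i)" for y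
  have "Q y \<bullet> u = y $ k" for y
  proof -
    have "Q y \<bullet> u = y \<bullet> axis k 1"
      using Q unfolding orthogonal_transformation_def by metis
    then show ?thesis
      by (simp add: inner_axis)
  qed
  moreover have "stretch y = l *\<^sub>R y + ((1 - l) * y $ k) *\<^sub>R axis k 1" for y
    by (simp add: stretch_def m_def vec_eq_iff axis_def algebra_simps)
  ultimately have commute: "axial_stretch u l (Q y) = Q (stretch y)" for y
    using Q orthogonal_transformation_linear[OF Q(1)]
    by (simp add: axial_stretch_def linear_add linear_scale)
  have "cball 0 1 = Q ` cball 0 1"
    using image_orthogonal_transformation_cball[OF Q(1), of 0 1] Q(1)
    by (simp add: linear_0 orthogonal_transformation_linear)
  then have "axial_stretch u l ` cball 0 1 = Q ` stretch ` cball 0 1"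
    by (metis (no_types, lifting) commute image_cong image_image)
  moreover have "stretch ` cball 0 1 \<in> lmeasurable"
    unfolding stretch_def by (simp add: measurable_stretch)
  moreover have "prod m UNIV = l ^ (CARD('n) - 1)"
    using prod.remove[of UNIV k m] by (simp add: m_def card_Diff_singleton)
  ultimately have "measure lebesgue (axial_stretch u l ` cball 0 1)
      = l ^ (CARD('n) - 1) * measure lebesgue (cball (0::real^'n) 1)"
    using measure_orthogonal_image_finite[OF Q(1)] measure_stretch[of "cball (0::real^'n) 1" m] l
    unfolding stretch_def by simp
  also have "measure lebesgue (cball (0::real^'n) 1) = unit_ball_vol CARD('n)"
    using content_cball[of 1 "0::real^'n"] by (simp add: measure_completion)
  finally show ?thesis
    by simp
qed

lemma cone_ellipsoid_ineq:
  fixes t s a :: real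
  assumes "0 \<le> t" "t < 1" "t * s \<le> a" "a \<le> s" "s \<le> 1"
  shows "(a - t)^2 * (1 - t^2) + (s^2 - a^2) \<le> 1 - t^2"
proof (cases "s = 0")
  case True
  with assms have "a = 0" and "t^2 \<le> 1"
    by (auto simp: power_le_one)
  with True show ?thesis
    by (simp add: mult_left_le_one_le)
next
  case False
  have "0 \<le> (1 - t) * s"
    using assms by (simp add: algebra_simps)
  then have s: "0 < s"
    using False assms by (simp add: zero_le_mult_iff)
  then have a: "0 \<le> a"
    using assms by (meson mult_nonneg_nonneg order_trans less_imp_le)
  define D where "D = 1 - t^2"
  have D: "0 \<le> D" "t^2 \<le> 1"
    using assms by (auto simp: D_def power_le_one)
  have "s * (D - D * (a - t)^2 + a^2 - s^2)
        = s * (1 - s) * D^2 + t * (a - t * s) * (s * (2 - t^2) + t * a)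
          + (1 - s) * ((s - t * a) * (s + t * a))"
    unfolding D_def by algebra
  also have "\<dots> \<ge> 0"
    using assms s a D mult_left_le_one_le[of a t]
    by (intro add_nonneg_nonneg mult_nonneg_nonneg) auto
  finally have "0 \<le> D - D * (a - t)^2 + a^2 - s^2"
    using s by (simp add: zero_le_mult_iff)
  then show ?thesis
    by (simp add: D_def algebra_simps)
qed

lemma cball_Int_circular_cone_subset_ellipsoid:
  fixes u :: "'a::real_inner"
  assumes u: "norm u = 1" and t: "0 \<le> t" "t < 1"
  shows "cball 0 1 \<inter> circular_cone u t \<subseteq> (+) (t *\<^sub>R u) ` axial_stretch u (sqrt (1 - t^2)) ` cball 0 1"
proof
  fix x assume x: "x \<in> cball 0 1 \<inter> circular_cone u t"
  define l where "l = sqrt (1 - t^2)"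
  have t2: "t^2 < 1"
    using t by (simp add: power_less_one_iff)
  then have l: "0 < l" "l^2 = 1 - t^2"
    by (auto simp: l_def)
  have uu: "u \<bullet> u = 1"
    using u by (simp add: dot_square_norm)
  define a where "a = x \<bullet> u"
  define s where "s = norm x"
  define w where "w = x - a *\<^sub>R u"
  have wu: "w \<bullet> u = 0"
    using uu by (simp add: w_def a_def inner_diff_left)
  have "x \<bullet> x = s^2"
    by (simp add: s_def power2_norm_eq_inner)
  then have ww: "w \<bullet> w = s^2 - a^2"
    using uu by (simp add: w_def a_def inner_diff_left inner_diff_right inner_commute power2_eq_square)
  define y where "y = (a - t) *\<^sub>R u + (1 / l) *\<^sub>R w"
  have "axial_stretch u l y = (a - t) *\<^sub>R u + w"
    using l uu wu by (simp add: y_def axial_stretch_def inner_add_left algebra_simps)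
  then have "x = t *\<^sub>R u + axial_stretch u l y"
    by (simp add: w_def algebra_simps)
  moreover have "norm y \<le> 1"
  proof -
    have "t * s \<le> a" "a \<le> s" "s \<le> 1"
      using x norm_cauchy_schwarz[of x u] u by (auto simp: a_def s_def circular_cone_def)
    then have "((a - t)^2 * (1 - t^2) + (s^2 - a^2)) / (1 - t^2) \<le> 1"
      using cone_ellipsoid_ineq[OF t] t2 by simp
    moreover have "y \<bullet> y = (a - t)^2 + (s^2 - a^2) / l^2"
      using uu wu ww by (simp add: y_def inner_add_left inner_add_right inner_commute power2_eq_square)
    then have "y \<bullet> y = ((a - t)^2 * (1 - t^2) + (s^2 - a^2)) / (1 - t^2)"
      using l t2 by (simp add: field_simps)
    ultimately show ?thesis
      by (simp add: norm_eq_sqrt_inner)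
  qed
  ultimately show "x \<in> (+) (t *\<^sub>R u) ` axial_stretch u (sqrt (1 - t^2)) ` cball 0 1"
    by (auto simp: l_def)
qed

lemma measure_cball_Int_circular_cone_le:
  fixes u :: "real^'n"
  assumes u: "norm u = 1" and t: "0 \<le> t" "t < 1"
  shows "measure lebesgue (cball 0 1 \<inter> circular_cone u t)
     \<le> unit_ball_vol CARD('n) * sqrt (1 - t^2) ^ (CARD('n) - 1)"
proof -
  let ?E = "(+) (t *\<^sub>R u) ` axial_stretch u (sqrt (1 - t^2)) ` cball 0 1"
  have "compact (axial_stretch u (sqrt (1 - t^2)) ` cball 0 1)"
    unfolding axial_stretch_def by (intro compact_continuous_image continuous_intros) auto
  then have "?E \<in> lmeasurable"
    by (intro measurable_translation lmeasurable_compact)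
  then have "measure lebesgue (cball 0 1 \<inter> circular_cone u t) \<le> measure lebesgue ?E"
    using cball_Int_circular_cone_subset_ellipsoid[OF u t]
      fmeasurableD[OF lmeasurable_cball_Int_circular_cone]
    by (intro measure_mono_fmeasurable) auto
  also have "\<dots> = unit_ball_vol CARD('n) * sqrt (1 - t^2) ^ (CARD('n) - 1)"
    using measure_axial_stretch_cball[OF u, of "sqrt (1 - t^2)"] t
    by (simp add: measure_translation power_le_one)
  finally show ?thesis .
qed

lemma measure_cball_Int_circular_cone_scale:
  fixes u :: "real^'n"
  assumes "0 < R"
  shows "measure lebesgue (cball 0 R \<inter> circular_cone u t)
       = R ^ CARD('n) * measure lebesgue (cball 0 1 \<inter> circular_cone u t)"
proof -
  have "(*\<^sub>R) R ` (cball 0 1 \<inter> circular_cone u t) = cball 0 R \<inter> circular_cone u t"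
  proof (intro equalityI subsetI)
    fix y assume "y \<in> (*\<^sub>R) R ` (cball 0 1 \<inter> circular_cone u t)"
    then show "y \<in> cball 0 R \<inter> circular_cone u t"
      using assms by (auto simp: circular_cone_def mult_left_le mult.left_commute)
  next
    fix y assume "y \<in> cball 0 R \<inter> circular_cone u t"
    then have "(1 / R) *\<^sub>R y \<in> cball 0 1 \<inter> circular_cone u t"
      using assms by (simp add: circular_cone_def field_simps)
    moreover have "y = R *\<^sub>R ((1 / R) *\<^sub>R y)"
      using assms by simp
    ultimately show "y \<in> (*\<^sub>R) R ` (cball 0 1 \<inter> circular_cone u t)"
      by blast
  qed
  moreover have "(*\<^sub>R) R = (\<lambda>x::real^'n. \<chi> i. R * x $ i)"
    by (simp add: fun_eq_iff vec_eq_iff)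
  ultimately show ?thesis
    using measure_stretch[OF lmeasurable_cball_Int_circular_cone, of "\<lambda>_. R" 1 u t] assms
    by simp
qed

section \<open>Spherical shells\<close>

definition shell :: "real \<Rightarrow> real \<Rightarrow> 'a::real_normed_vector set" where
  "shell a b = {x. a < norm x \<and> norm x \<le> b}"

lemma shell_eq_Diff: "shell a b = cball 0 b - cball 0 a"
  by (auto simp: shell_def)

lemma shell_borel [measurable]: "shell a b \<in> sets borel"
  unfolding shell_def by measurable

lemma bounded_shell: "bounded (shell a b)"
  by (auto simp: shell_def bounded_iff)

lemma measure_shell:
  assumes "0 \<le> a" "a \<le> b"
  shows "measure lborel (shell a b :: (real^'n) set)
       = unit_ball_vol CARD('n) * (b ^ CARD('n) - a ^ CARD('n))"
proof -
  have "measure lborel (cball 0 b - cball 0 a :: (real^'n) set)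
      = measure lborel (cball 0 b :: (real^'n) set) - measure lborel (cball 0 a :: (real^'n) set)"
    using assms emeasure_lborel_cball_finite[of "0::real^'n" b] by (intro measure_Diff) auto
  then show ?thesis
    using assms content_cball[of a "0::real^'n"] content_cball[of b "0::real^'n"]
    by (simp add: shell_eq_Diff algebra_simps)
qed

lemma power_diff_le_linear:
  fixes a b r :: real
  assumes "0 \<le> a" "a \<le> b" "b \<le> r"
  shows "b ^ n - a ^ n \<le> real n * r ^ (n - 1) * (b - a)"
proof -
  have "(\<Sum>i<n. a ^ (n - Suc i) * b ^ i) \<le> (\<Sum>i<n. r ^ (n - Suc i) * r ^ i)"
    using assms by (intro sum_mono mult_mono power_mono) auto
  also have "\<dots> = real n * r ^ (n - 1)"
    by (simp add: power_add[symmetric])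
  finally show ?thesis
    using assms power_diff_sumr2[of b n a] by (simp add: mult_left_mono mult.commute)
qed

lemma measure_shell_le:
  assumes "0 \<le> a" "a \<le> b" "b \<le> r"
  shows "measure lborel (shell a b :: (real^'n) set)
       \<le> unit_ball_vol CARD('n) * CARD('n) * r ^ (CARD('n) - 1) * (b - a)"
  using assms measure_shell[of a b, where 'n = 'n] power_diff_le_linear[OF assms, of "CARD('n)"]
  by (simp add: mult_left_mono mult.assoc)

lemma emeasure_lborel_bounded:
  fixes S :: "'a::euclidean_space set"
  assumes "S \<in> sets borel" "bounded S"
  shows "emeasure lborel S = ennreal (measure lborel S)"
  using assms emeasure_bounded_finite[of S]
  by (simp add: emeasure_eq_ennreal_measure less_top)

text \<open>For \<open>d = \<lambda>\<^sub>j / 2\<close> this is the weight in the paper's bound. It dominates the fraction of the sphere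
  of radius \<open>\<rho>\<close> lying beyond a hyperplane at distance \<open>d\<close> from the origin.\<close>

definition cap_bound :: "nat \<Rightarrow> real \<Rightarrow> real \<Rightarrow> real" where
  "cap_bound n d \<rho> = (1 - (d / \<rho>)^2) powr ((real n - 1) / 2)"

lemma cap_bound_nonneg: "0 \<le> cap_bound n d \<rho>"
  by (simp add: cap_bound_def)

lemma borel_measurable_cap_bound [measurable]: "cap_bound n d \<in> borel_measurable borel"
  unfolding cap_bound_def[abs_def] by measurable

lemma cap_bound_mono:
  assumes "0 < d" "d \<le> \<rho>" "\<rho> \<le> \<rho>'" "1 \<le> n"
  shows "cap_bound n d \<rho> \<le> cap_bound n d \<rho>'"
proof -
  have "d / \<rho>' \<le> d / \<rho>" "d / \<rho> \<le> 1"
    using assms by (auto intro: divide_left_mono)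
  then have "(d / \<rho>')^2 \<le> (d / \<rho>)^2" "(d / \<rho>)^2 \<le> 1"
    using assms by (auto intro!: power_mono power_le_one)
  then show ?thesis
    unfolding cap_bound_def using assms by (intro powr_mono2) auto
qed

lemma cap_bound_le_1:
  assumes "0 < d" "d \<le> \<rho>" "1 \<le> n"
  shows "cap_bound n d \<rho> \<le> 1"
proof -
  have "(d / \<rho>)^2 \<le> 1"
    using assms by (intro power_le_one) auto
  then have "cap_bound n d \<rho> \<le> 1 powr ((real n - 1) / 2)"
    unfolding cap_bound_def using assms by (intro powr_mono2) auto
  then show ?thesis
    by simp
qed

lemma cap_bound_eq_sqrt_power:
  assumes "0 < d" "d < \<rho>" "1 \<le> n"
  shows "cap_bound n d \<rho> = sqrt (1 - (d / \<rho>)^2) ^ (n - 1)"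
proof -
  have "(d / \<rho>)^2 < 1"
    using assms by (simp add: power_less_one_iff)
  then have pos: "0 < 1 - (d / \<rho>)^2"
    by simp
  have "sqrt (1 - (d / \<rho>)^2) ^ (n - 1) = (1 - (d / \<rho>)^2) powr (real (n - 1) / 2)"
    using pos by (simp add: powr_half_sqrt[symmetric] powr_realpow[symmetric] powr_powr)
  then show ?thesis
    using assms by (simp add: cap_bound_def of_nat_diff)
qed

lemma measure_shell_Int_halfspace_le:
  fixes u :: "real^'n"
  assumes u: "norm u = 1" and "0 < d" "0 < a" "a \<le> b" "d < b"
  shows "measure lborel (shell a b \<inter> {x. d \<le> x \<bullet> u})
       \<le> cap_bound CARD('n) d b * measure lborel (shell a b :: (real^'n) set)"
proof -
  define t where "t = d / b"
  have t: "0 \<le> t" "t < 1" and b: "0 < b"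
    using assms by (auto simp: t_def)
  let ?C = "\<lambda>R. cball 0 R \<inter> circular_cone u t"
  have "shell a b \<inter> {x. d \<le> x \<bullet> u} \<subseteq> ?C b - ?C a"
  proof
    fix x :: "real^'n" assume x: "x \<in> shell a b \<inter> {x. d \<le> x \<bullet> u}"
    then have "t * norm x \<le> t * b"
      using t by (intro mult_left_mono) (auto simp: shell_def)
    then show "x \<in> ?C b - ?C a"
      using x b by (auto simp: shell_def circular_cone_def t_def)
  qed
  moreover have borel: "shell a b \<inter> {x. d \<le> x \<bullet> u} \<in> sets borel"
    by measurable
  ultimately have "measure lebesgue (shell a b \<inter> {x. d \<le> x \<bullet> u}) \<le> measure lebesgue (?C b - ?C a)"
    by (intro measure_mono_fmeasurable fmeasurable.Diff lmeasurable_cball_Int_circular_cone) auto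
  then have "measure lborel (shell a b \<inter> {x. d \<le> x \<bullet> u}) \<le> measure lebesgue (?C b - ?C a)"
    using borel by (simp add: measure_completion)
  also have "\<dots> = measure lebesgue (?C b) - measure lebesgue (?C a)"
    using assms fmeasurableD2[OF lmeasurable_cball_Int_circular_cone, of b u t]
    by (intro measure_Diff fmeasurableD lmeasurable_cball_Int_circular_cone) auto
  also have "\<dots> = (b ^ CARD('n) - a ^ CARD('n)) * measure lebesgue (?C 1)"
    using assms measure_cball_Int_circular_cone_scale[of a u t]
      measure_cball_Int_circular_cone_scale[of b u t]
    by (simp add: algebra_simps)
  also have "\<dots> \<le> (b ^ CARD('n) - a ^ CARD('n))
                   * (unit_ball_vol CARD('n) * sqrt (1 - t^2) ^ (CARD('n) - 1))"
    using assms measure_cball_Int_circular_cone_le[OF u t] power_mono[of a b "CARD('n)"]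
    by (intro mult_left_mono) auto
  also have "\<dots> = cap_bound CARD('n) d b * (unit_ball_vol CARD('n) * (b ^ CARD('n) - a ^ CARD('n)))"
    using assms by (simp add: t_def cap_bound_eq_sqrt_power Suc_leI)
  also have "\<dots> = cap_bound CARD('n) d b * measure lborel (shell a b :: (real^'n) set)"
    using assms by (simp add: measure_shell)
  finally show ?thesis .
qed

section \<open>Radial integrals over half-spaces\<close>

text \<open>The gap between an upper Riemann sum (\<open>G\<close> at left, \<open>C\<close> at right endpoints) and the
  matching lower sum telescopes.\<close>

lemma sum_shifted_products_le:
  fixes G C D :: "nat \<Rightarrow> real"
  assumes G: "decseq G" "\<And>k. 0 \<le> G k" and C: "incseq C" "\<And>k. 0 \<le> C k" "\<And>k. C k \<le> 1"
    and D: "\<And>k. k < N \<Longrightarrow> 0 \<le> D k \<and> D k \<le> \<delta>" and "0 \<le> \<delta>"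
  shows "(\<Sum>k<N. G k * C (Suc k) * D k) \<le> (\<Sum>k<N. G (Suc k) * C k * D k) + 2 * G 0 * \<delta>"
proof -
  have step: "G k * C (Suc k) * D k - G (Suc k) * C k * D k
      \<le> (G 0 * (C (Suc k) - C k) + (G k - G (Suc k))) * \<delta>"
    if "k < N" for k
  proof -
    have "G (Suc k) \<le> G k" "G k \<le> G 0" "C k \<le> C (Suc k)"
      using G C by (auto simp: decseq_def incseq_def)
    then have "G k * (C (Suc k) - C k) + C k * (G k - G (Suc k))
             \<le> G 0 * (C (Suc k) - C k) + (G k - G (Suc k))"
      and "0 \<le> G k * (C (Suc k) - C k) + C k * (G k - G (Suc k))"
      using G(2)[of k] C(2,3)[of k] by (auto intro!: add_mono mult_right_mono mult_left_le_one_le)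
    then have "(G k * (C (Suc k) - C k) + C k * (G k - G (Suc k))) * D k
             \<le> (G 0 * (C (Suc k) - C k) + (G k - G (Suc k))) * \<delta>"
      using D[OF that] by (meson mult_left_mono mult_right_mono order_trans)
    then show ?thesis
      by (simp add: algebra_simps)
  qed
  have "(\<Sum>k<N. G k * C (Suc k) * D k) - (\<Sum>k<N. G (Suc k) * C k * D k)
      \<le> (\<Sum>k<N. (G 0 * (C (Suc k) - C k) + (G k - G (Suc k))) * \<delta>)"
    unfolding sum_subtractf[symmetric] by (intro sum_mono step) simp
  also have "\<dots> = (G 0 * (C N - C 0) + (G 0 - G N)) * \<delta>"
    by (simp add: sum_distrib_right[symmetric] sum.distrib sum_distrib_left[symmetric]
        sum_lessThan_telescope sum_lessThan_telescope')
  also have "\<dots> \<le> 2 * G 0 * \<delta>"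
  proof -
    have "G 0 * (C N - C 0) \<le> G 0"
      using G(2)[of 0] C(2)[of 0] C(3)[of N] by (intro mult_left_le) auto
    then show ?thesis
      using G(2)[of N] \<open>0 \<le> \<delta>\<close> by (intro mult_right_mono) auto
  qed
  finally show ?thesis
    by simp
qed

lemma sum_indicator_partition:
  fixes a :: "nat \<Rightarrow> real"
  assumes "incseq a"
  shows "(\<Sum>k<N. indicator {a k<..a (Suc k)} \<rho> :: ennreal) = indicator {a 0<..a N} \<rho>"
proof (induction N)
  case (Suc N)
  have "a 0 \<le> a N" "a N \<le> a (Suc N)"
    using assms by (auto simp: incseq_def)
  then show ?case
    using Suc by (auto simp: indicator_def)
qed simp

lemma indicator_shell: "indicator (shell a b) x = indicator {a<..b} (norm x)"
  by (simp add: shell_def indicator_def)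

lemma nn_integral_shell_le_sum:
  fixes G :: "real \<Rightarrow> real" and H :: "'a::euclidean_space set"
  assumes a: "incseq a" "0 \<le> a 0" and G: "\<And>s t. 0 \<le> s \<Longrightarrow> s \<le> t \<Longrightarrow> G t \<le> G s"
    and H: "H \<in> sets borel"
  shows "(\<integral>\<^sup>+x. ennreal (G (norm x)) * indicator (shell (a 0) (a N) \<inter> H) x \<partial>lborel)
     \<le> (\<Sum>k<N. ennreal (G (a k)) * emeasure lborel (shell (a k) (a (Suc k)) \<inter> H))"
proof -
  have "ennreal (G (norm x)) * indicator (shell (a 0) (a N) \<inter> H) x
      \<le> (\<Sum>k<N. ennreal (G (a k)) * indicator (shell (a k) (a (Suc k)) \<inter> H) x)" for x
  proof -
    have "ennreal (G (norm x)) * indicator (shell (a 0) (a N) \<inter> H) x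
        = (\<Sum>k<N. ennreal (G (norm x)) * indicator (shell (a k) (a (Suc k)) \<inter> H) x)"
      unfolding sum_distrib_left[symmetric] indicator_inter_arith[of _ H] indicator_shell
        sum_distrib_right[symmetric] sum_indicator_partition[OF a(1)] ..
    also have "\<dots> \<le> (\<Sum>k<N. ennreal (G (a k)) * indicator (shell (a k) (a (Suc k)) \<inter> H) x)"
    proof (intro sum_mono)
      fix k
      have "a 0 \<le> a k"
        using a(1) by (simp add: incseq_def)
      then have "x \<in> shell (a k) (a (Suc k)) \<Longrightarrow> G (norm x) \<le> G (a k)"
        using a(2) G by (simp add: shell_def)
      then show "ennreal (G (norm x)) * indicator (shell (a k) (a (Suc k)) \<inter> H) x
               \<le> ennreal (G (a k)) * indicator (shell (a k) (a (Suc k)) \<inter> H) x"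
        by (auto simp: indicator_def intro: ennreal_leI)
    qed
    finally show ?thesis .
  qed
  then have "(\<integral>\<^sup>+x. ennreal (G (norm x)) * indicator (shell (a 0) (a N) \<inter> H) x \<partial>lborel)
      \<le> (\<integral>\<^sup>+x. (\<Sum>k<N. ennreal (G (a k)) * indicator (shell (a k) (a (Suc k)) \<inter> H) x) \<partial>lborel)"
    by (intro nn_integral_mono)
  also have "\<dots> = (\<Sum>k<N. (\<integral>\<^sup>+x. ennreal (G (a k)) * indicator (shell (a k) (a (Suc k)) \<inter> H) x \<partial>lborel))"
    using H by (intro nn_integral_sum) simp
  also have "\<dots> = (\<Sum>k<N. ennreal (G (a k)) * emeasure lborel (shell (a k) (a (Suc k)) \<inter> H))"
    using H by (intro sum.cong refl nn_integral_cmult_indicator) simp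
  finally show ?thesis .
qed

lemma sum_le_nn_integral_shell:
  fixes G c :: "real \<Rightarrow> real"
  assumes a: "incseq a" "0 \<le> a 0"
    and G: "\<And>s. 0 \<le> G s" "\<And>s t. 0 \<le> s \<Longrightarrow> s \<le> t \<Longrightarrow> G t \<le> G s"
    and c: "\<And>s. a 0 \<le> s \<Longrightarrow> 0 \<le> c s" "\<And>s t. a 0 \<le> s \<Longrightarrow> s \<le> t \<Longrightarrow> c s \<le> c t"
  shows "ennreal (\<Sum>k<N. G (a (Suc k)) * c (a k)
                           * measure lborel (shell (a k) (a (Suc k)) :: 'a::euclidean_space set))
     \<le> (\<integral>\<^sup>+x. ennreal (G (norm x) * c (norm x)) * indicator (shell (a 0) (a N)) x
           \<partial>(lborel :: 'a measure))"
proof -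
  have pointwise: "(\<Sum>k<N. ennreal (G (a (Suc k)) * c (a k)) * indicator (shell (a k) (a (Suc k))) x)
      \<le> ennreal (G (norm x) * c (norm x)) * indicator (shell (a 0) (a N)) x" for x :: 'a
  proof -
    have "(\<Sum>k<N. ennreal (G (a (Suc k)) * c (a k)) * indicator (shell (a k) (a (Suc k))) x)
        \<le> (\<Sum>k<N. ennreal (G (norm x) * c (norm x)) * indicator (shell (a k) (a (Suc k))) x)"
    proof (intro sum_mono)
      fix k
      have "a 0 \<le> a k"
        using a(1) by (simp add: incseq_def)
      then have "x \<in> shell (a k) (a (Suc k)) \<Longrightarrow> G (a (Suc k)) * c (a k) \<le> G (norm x) * c (norm x)"
        using a(2) G c by (intro mult_mono) (auto simp: shell_def)
      then show "ennreal (G (a (Suc k)) * c (a k)) * indicator (shell (a k) (a (Suc k))) x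
               \<le> ennreal (G (norm x) * c (norm x)) * indicator (shell (a k) (a (Suc k))) x"
        by (auto simp: indicator_def intro: ennreal_leI)
    qed
    also have "\<dots> = ennreal (G (norm x) * c (norm x)) * indicator (shell (a 0) (a N)) x"
      unfolding sum_distrib_left[symmetric] indicator_shell sum_indicator_partition[OF a(1)] ..
    finally show ?thesis .
  qed
  have "c (a k) \<ge> 0" for k
    using a c(1) by (simp add: incseq_def)
  then have "ennreal (\<Sum>k<N. G (a (Suc k)) * c (a k) * measure lborel (shell (a k) (a (Suc k)) :: 'a set))
      = (\<Sum>k<N. ennreal (G (a (Suc k)) * c (a k)) * emeasure lborel (shell (a k) (a (Suc k)) :: 'a set))"
    using G(1) by (subst sum_ennreal[symmetric])
      (auto simp: ennreal_mult' emeasure_lborel_bounded bounded_shell intro!: sum.cong)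
  also have "\<dots>
      = (\<integral>\<^sup>+x. (\<Sum>k<N. ennreal (G (a (Suc k)) * c (a k)) * indicator (shell (a k) (a (Suc k))) x)
            \<partial>(lborel :: 'a measure))"
    by (subst nn_integral_sum) (simp_all add: nn_integral_cmult_indicator)
  also have "\<dots> \<le> (\<integral>\<^sup>+x. ennreal (G (norm x) * c (norm x)) * indicator (shell (a 0) (a N)) x
                     \<partial>(lborel :: 'a measure))"
    by (intro nn_integral_mono pointwise)
  finally show ?thesis .
qed

lemma nn_integral_shell_Int_halfspace_le_upper_sum:
  fixes G :: "real \<Rightarrow> real" and u :: "real^'n"
  assumes a: "strict_mono a" "0 < a 0"
    and G: "\<And>s. 0 \<le> G s" "\<And>s t. 0 \<le> s \<Longrightarrow> s \<le> t \<Longrightarrow> G t \<le> G s" and u: "norm u = 1"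
  shows "(\<integral>\<^sup>+x. ennreal (G (norm x)) * indicator (shell (a 0) (a N) \<inter> {x. a 0 \<le> x \<bullet> u}) x \<partial>lborel)
     \<le> ennreal (\<Sum>k<N. G (a k) * cap_bound CARD('n) (a 0) (a (Suc k))
                           * measure lborel (shell (a k) (a (Suc k)) :: (real^'n) set))"
proof -
  let ?H = "{x::real^'n. a 0 \<le> x \<bullet> u}" and ?c = "cap_bound CARD('n) (a 0)"
  have a_le: "a 0 \<le> a k" "a k \<le> a (Suc k)" "a 0 < a (Suc k)" for k
    using a(1) by (auto simp: strict_mono_less_eq strict_mono_less)
  have "(\<integral>\<^sup>+x. ennreal (G (norm x)) * indicator (shell (a 0) (a N) \<inter> ?H) x \<partial>lborel)
      \<le> (\<Sum>k<N. ennreal (G (a k)) * emeasure lborel (shell (a k) (a (Suc k)) \<inter> ?H))"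
    by (rule nn_integral_shell_le_sum[where G = G]) (use a(2) strict_mono_mono[OF a(1)] G(2) in auto)
  also have "\<dots> \<le> (\<Sum>k<N. ennreal (G (a k)) * ennreal (?c (a (Suc k))
                      * measure lborel (shell (a k) (a (Suc k)) :: (real^'n) set)))"
  proof (intro sum_mono mult_left_mono)
    fix k
    have "emeasure lborel (shell (a k) (a (Suc k)) \<inter> ?H)
        = ennreal (measure lborel (shell (a k) (a (Suc k)) \<inter> ?H))"
      by (intro emeasure_lborel_bounded) (auto intro: bounded_Int bounded_shell)
    also have "\<dots> \<le> ennreal (?c (a (Suc k)) * measure lborel (shell (a k) (a (Suc k)) :: (real^'n) set))"
      using a(2) a_le[of k] by (intro ennreal_leI measure_shell_Int_halfspace_le u) auto
    finally show "emeasure lborel (shell (a k) (a (Suc k)) \<inter> ?H)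
        \<le> ennreal (?c (a (Suc k)) * measure lborel (shell (a k) (a (Suc k)) :: (real^'n) set))" .
  qed simp
  also have "\<dots> = ennreal (\<Sum>k<N. G (a k) * ?c (a (Suc k))
                                  * measure lborel (shell (a k) (a (Suc k)) :: (real^'n) set))"
    using G(1) by (subst sum_ennreal[symmetric]) (auto simp: ennreal_mult' mult.assoc cap_bound_nonneg)
  finally show ?thesis .
qed

lemma nn_integral_shell_Int_halfspace_le_approx:
  fixes G :: "real \<Rightarrow> real" and u :: "real^'n" and N :: nat
  assumes G: "\<And>s. 0 \<le> G s" "\<And>s t. 0 \<le> s \<Longrightarrow> s \<le> t \<Longrightarrow> G t \<le> G s"
    and u: "norm u = 1" and "0 < d" "d < r" "0 < N"
  shows "(\<integral>\<^sup>+x. ennreal (G (norm x)) * indicator (shell d r \<inter> {x. d \<le> x \<bullet> u}) x \<partial>lborel)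
     \<le> (\<integral>\<^sup>+x. ennreal (G (norm x) * cap_bound CARD('n) d (norm x)) * indicator (shell d r) x
           \<partial>(lborel :: (real^'n) measure))
        + ennreal (2 * G d * unit_ball_vol CARD('n) * CARD('n) * r ^ (CARD('n) - 1) * (r - d) / N)"
proof -
  define h where "h = (r - d) / N"
  define a where "a k = d + real k * h" for k
  define D where "D k = measure lborel (shell (a k) (a (Suc k)) :: (real^'n) set)" for k
  define \<delta> where "\<delta> = unit_ball_vol CARD('n) * CARD('n) * r ^ (CARD('n) - 1) * h"
  let ?c = "cap_bound CARD('n) d"
  have h: "0 < h"
    using assms by (simp add: h_def)
  have a: "strict_mono a" "a 0 = d" "a N = r" "\<And>k. a (Suc k) = a k + h" "\<And>k. d \<le> a k"
    using h \<open>0 < N\<close> by (auto simp: a_def strict_mono_def algebra_simps) (simp add: h_def)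
  have n: "1 \<le> CARD('n)"
    by (simp add: Suc_leI)
  have D: "0 \<le> D k \<and> D k \<le> \<delta>" if "k < N" for k
  proof -
    have "0 \<le> a k" "a (Suc k) \<le> a N"
      using that a(1) a(5)[of k] \<open>0 < d\<close> by (simp_all add: strict_mono_less_eq)
    then show ?thesis
      using measure_shell_le[of "a k" "a (Suc k)" r, where 'n = 'n] a(3,4,5) h \<open>0 < d\<close>
      by (simp add: D_def \<delta>_def)
  qed
  have "(\<integral>\<^sup>+x. ennreal (G (norm x)) * indicator (shell d r \<inter> {x. d \<le> x \<bullet> u}) x \<partial>lborel)
      \<le> ennreal (\<Sum>k<N. G (a k) * ?c (a (Suc k)) * D k)"
    using nn_integral_shell_Int_halfspace_le_upper_sum[where G = G and N = N, OF a(1) _ G u]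
      a(2,3) \<open>0 < d\<close>
    by (simp add: D_def)
  also have "\<dots> \<le> ennreal ((\<Sum>k<N. G (a (Suc k)) * ?c (a k) * D k) + 2 * G (a 0) * \<delta>)"
  proof (intro ennreal_leI sum_shifted_products_le)
    have ak: "0 \<le> a k" "d \<le> a k" "a k \<le> a k'" if "k \<le> k'" for k k'
      using a(1) a(5)[of k] that \<open>0 < d\<close> by (auto simp: strict_mono_less_eq)
    show "decseq (\<lambda>k. G (a k))"
      unfolding decseq_def using G(2) ak by blast
    show "incseq (\<lambda>k. ?c (a k))"
      unfolding incseq_def using cap_bound_mono[OF \<open>0 < d\<close> _ _ n] ak by blast
    show "?c (a k) \<le> 1" for k
      using cap_bound_le_1[OF \<open>0 < d\<close> a(5) n] .
    show "0 \<le> \<delta>"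
      using h \<open>d < r\<close> \<open>0 < d\<close> by (simp add: \<delta>_def)
  qed (use G(1) D cap_bound_nonneg in auto)
  also have "\<dots> = ennreal (\<Sum>k<N. G (a (Suc k)) * ?c (a k) * D k) + ennreal (2 * G (a 0) * \<delta>)"
    using G(1) D h \<open>0 < d\<close> \<open>d < r\<close>
    by (intro ennreal_plus sum_nonneg) (auto simp: \<delta>_def cap_bound_nonneg)
  also have "ennreal (\<Sum>k<N. G (a (Suc k)) * ?c (a k) * D k)
      \<le> (\<integral>\<^sup>+x. ennreal (G (norm x) * ?c (norm x)) * indicator (shell d r) x
            \<partial>(lborel :: (real^'n) measure))"
    unfolding D_def a(2)[symmetric] a(3)[symmetric]
    by (rule sum_le_nn_integral_shell)
      (use strict_mono_mono[OF a(1)] G cap_bound_mono[OF \<open>0 < d\<close> _ _ n] \<open>0 < d\<close>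
        in \<open>auto simp: a(2) cap_bound_nonneg\<close>)
  finally show ?thesis
    using a(2) by (simp add: \<delta>_def h_def mult.assoc)
qed

lemma eq_scaleR_if_inner_ge_norm_le:
  fixes x u :: "'a::real_inner"
  assumes "norm u = 1" "d \<le> x \<bullet> u" "norm x \<le> d"
  shows "x = d *\<^sub>R u"
proof -
  have "0 \<le> d"
    using assms by (meson norm_ge_zero order_trans)
  have "u \<bullet> u = 1"
    using assms(1) by (simp add: dot_square_norm)
  then have "(x - d *\<^sub>R u) \<bullet> (x - d *\<^sub>R u) = x \<bullet> x - 2 * d * (x \<bullet> u) + d^2"
    by (simp add: inner_diff_left inner_diff_right inner_commute power2_eq_square algebra_simps)
  also have "\<dots> \<le> 0"
    using assms \<open>0 \<le> d\<close> mult_left_mono[OF assms(2), of d] power_mono[OF assms(3), of 2]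
    by (simp add: dot_square_norm power2_eq_square)
  finally have "(x - d *\<^sub>R u) \<bullet> (x - d *\<^sub>R u) = 0"
    by (meson antisym inner_ge_zero)
  then show ?thesis
    by simp
qed

lemma AE_indicator_cball_Int_halfspace_eq_shell:
  fixes u :: "real^'n"
  assumes u: "norm u = 1"
  shows "AE x in lborel. indicator (cball 0 r \<inter> {x. d \<le> x \<bullet> u}) x
                       = (indicator (shell d r \<inter> {x. d \<le> x \<bullet> u}) x :: ennreal)"
proof -
  have "AE x in lborel. x \<notin> {d *\<^sub>R u}"
    by (rule AE_not_in) (simp add: finite_imp_null_set_lborel)
  then show ?thesis
  proof eventually_elim
    case (elim x)
    then have "x \<in> cball 0 r \<inter> {x. d \<le> x \<bullet> u} \<longleftrightarrow> x \<in> shell d r \<inter> {x. d \<le> x \<bullet> u}"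
      using eq_scaleR_if_inner_ge_norm_le[OF u, of d x] by (auto simp: shell_def) (meson not_le)
    then show ?case
      unfolding indicator_def by simp
  qed
qed

lemma nn_integral_cball_Int_halfspace_le:
  fixes G :: "real \<Rightarrow> real" and u :: "real^'n"
  assumes G: "\<And>s. 0 \<le> G s" "\<And>s t. 0 \<le> s \<Longrightarrow> s \<le> t \<Longrightarrow> G t \<le> G s"
    and u: "norm u = 1" and "0 < d" "d \<le> r"
  shows "(\<integral>\<^sup>+x. ennreal (G (norm x)) * indicator (cball 0 r \<inter> {x. d \<le> x \<bullet> u}) x \<partial>lborel)
     \<le> (\<integral>\<^sup>+x. ennreal (G (norm x) * cap_bound CARD('n) d (norm x)) * indicator (shell d r) x
           \<partial>(lborel :: (real^'n) measure))"
    (is "?L \<le> ?R")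
proof -
  have L: "?L = (\<integral>\<^sup>+x. ennreal (G (norm x)) * indicator (shell d r \<inter> {x. d \<le> x \<bullet> u}) x \<partial>lborel)"
    using AE_indicator_cball_Int_halfspace_eq_shell[OF u, of r d] by (intro nn_integral_cong_AE) auto
  show ?thesis
  proof (cases "d = r")
    case True
    then show ?thesis
      unfolding L by (simp add: shell_def)
  next
    case False
    show ?thesis
    proof (rule ennreal_le_epsilon)
      fix \<epsilon> :: real
      assume "0 < \<epsilon>"
      define K where "K = 2 * G d * unit_ball_vol CARD('n) * CARD('n) * r ^ (CARD('n) - 1) * (r - d)"
      obtain N :: nat where N: "K / \<epsilon> < N"
        using reals_Archimedean2 by blast
      have "0 \<le> K"
        using G(1) \<open>0 < d\<close> \<open>d \<le> r\<close> by (simp add: K_def)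
      then have "0 < real N"
        using N \<open>0 < \<epsilon>\<close> by (meson divide_nonneg_pos le_less_trans)
      then have "0 < N" "K / N \<le> \<epsilon>"
        using N \<open>0 < \<epsilon>\<close> by (simp_all add: field_simps)
      have "?L \<le> ?R + ennreal (K / N)"
        unfolding L K_def
        by (rule nn_integral_shell_Int_halfspace_le_approx[where G = G])
          (use G u False \<open>d \<le> r\<close> \<open>0 < d\<close> \<open>0 < N\<close> in auto)
      also have "\<dots> \<le> ?R + \<epsilon>"
        using \<open>K / N \<le> \<epsilon>\<close> by (intro add_left_mono ennreal_leI)
      finally show "?L \<le> ?R + \<epsilon>" .
    qed
  qed
qed

section \<open>Noise with a radial density\<close>

lemma integrable_density_of_distributed:
  fixes X :: "'a \<Rightarrow> real" and f :: "real \<Rightarrow> real"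
  assumes "prob_space M" and dens: "distributed M lborel X (\<lambda>\<rho>. ennreal (f \<rho>))" and "\<forall>\<rho>. 0 \<le> f \<rho>"
  shows "integrable lborel f"
proof -
  interpret prob_space M by fact
  have "(\<integral>\<^sup>+x. ennreal (f x) \<partial>lborel) = emeasure M (X -` UNIV \<inter> space M)"
    using distributed_emeasure[OF dens, of UNIV] by simp
  then have "(\<integral>\<^sup>+x. ennreal (f x) \<partial>lborel) = 1"
    by (simp add: emeasure_space_1)
  then show ?thesis
    using distributed_real_measurable[of lborel f M X] dens assms(3)
    by (intro integrableI_nonneg) auto
qed

lemma measure_distributed_eq_set_integral:
  fixes X :: "'a \<Rightarrow> real" and f :: "real \<Rightarrow> real"
  assumes "prob_space M" and dens: "distributed M lborel X (\<lambda>\<rho>. ennreal (f \<rho>))" and f: "\<forall>\<rho>. 0 \<le> f \<rho>"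
    and A: "A \<in> sets borel"
  shows "measure M (X -` A \<inter> space M) = (LINT \<rho>:A|lborel. f \<rho>)"
proof -
  interpret prob_space M by fact
  have "ennreal (measure M (X -` A \<inter> space M)) = (\<integral>\<^sup>+\<rho>. ennreal (f \<rho>) * indicator A \<rho> \<partial>lborel)"
    using distributed_emeasure[OF dens] A by (simp add: emeasure_eq_measure)
  also have "\<dots> = ennreal (LINT \<rho>:A|lborel. f \<rho>)"
    using integrable_density_of_distributed[OF assms(1-3)] f A
    by (intro nn_set_integral_eq_set_integral) auto
  moreover have "0 \<le> (LINT \<rho>:A|lborel. f \<rho>)"
    unfolding set_lebesgue_integral_def using f by (intro Bochner_Integration.integral_nonneg) simp
  ultimately show ?thesis
    by simp
qed

lemma set_integral_weighted_density:
  fixes f c :: "real \<Rightarrow> real"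
  assumes f: "integrable lborel f" "\<And>\<rho>. 0 \<le> f \<rho>" and c: "c \<in> borel_measurable borel"
    "\<And>\<rho>. \<rho> \<in> A \<Longrightarrow> 0 \<le> c \<rho> \<and> c \<rho> \<le> 1" and A: "A \<in> sets borel"
  shows "(\<integral>\<^sup>+\<rho>. ennreal (indicator A \<rho> * (f \<rho> * c \<rho>)) \<partial>lborel) = ennreal (LINT \<rho>:A|lborel. f \<rho> * c \<rho>)"
    and "0 \<le> (LINT \<rho>:A|lborel. f \<rho> * c \<rho>)"
proof -
  have bound: "0 \<le> indicator A \<rho> * (f \<rho> * c \<rho>) \<and> indicator A \<rho> * (f \<rho> * c \<rho>) \<le> f \<rho>" for \<rho>
    using f(2)[of \<rho>] c(2)[of \<rho>] by (cases "\<rho> \<in> A") (auto intro: mult_left_le)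
  have "integrable lborel (\<lambda>\<rho>. indicator A \<rho> * (f \<rho> * c \<rho>))"
    using bound f c A borel_measurable_integrable[OF f(1)]
    by (intro Bochner_Integration.integrable_bound[OF f(1)])
      (auto intro!: AE_I2 order_trans[OF _ abs_ge_self])
  then show "(\<integral>\<^sup>+\<rho>. ennreal (indicator A \<rho> * (f \<rho> * c \<rho>)) \<partial>lborel)
      = ennreal (LINT \<rho>:A|lborel. f \<rho> * c \<rho>)"
    unfolding set_lebesgue_integral_def using bound by (subst nn_integral_eq_integral) auto
  show "0 \<le> (LINT \<rho>:A|lborel. f \<rho> * c \<rho>)"
    unfolding set_lebesgue_integral_def using bound by (intro Bochner_Integration.integral_nonneg) simp
qed

lemma emeasure_cball_Int_halfspace_le:
  fixes M :: "'a measure" and z :: "'a \<Rightarrow> real^'n" and g f :: "real \<Rightarrow> real" and u :: "real^'n"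
  assumes noise: "distributed M lborel z (\<lambda>x. ennreal (g (norm x)))"
    and g_noninc: "\<forall>s t. 0 \<le> s \<longrightarrow> s \<le> t \<longrightarrow> g t \<le> g s"
    and f_dens: "distributed M lborel (\<lambda>\<omega>. norm (z \<omega>)) (\<lambda>\<rho>. ennreal (f \<rho>))"
    and u: "norm u = 1" and "0 < d" "d \<le> r"
  shows "emeasure M {\<omega> \<in> space M. norm (z \<omega>) \<le> r \<and> d \<le> z \<omega> \<bullet> u}
     \<le> (\<integral>\<^sup>+\<rho>. ennreal (f \<rho>) * (ennreal (cap_bound CARD('n) d \<rho>) * indicator {d<..r} \<rho>) \<partial>lborel)"
proof -
  define G where "G s = max (g s) 0" for s
  define h where "h \<rho> = ennreal (cap_bound CARD('n) d \<rho>) * indicator {d<..r} \<rho>" for \<rho>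
  have g_G: "ennreal (g s) = ennreal (G s)" for s
    by (simp add: G_def ennreal_max_0 max.commute)
  have G: "0 \<le> G s" "0 \<le> s \<Longrightarrow> s \<le> t \<Longrightarrow> G t \<le> G s" for s t
  proof -
    show "0 \<le> G s"
      by (simp add: G_def)
    assume "0 \<le> s" "s \<le> t"
    then have "g t \<le> g s"
      using g_noninc by blast
    then show "G t \<le> G s"
      unfolding G_def by (rule max.mono) simp
  qed
  have [measurable]: "h \<in> borel_measurable borel"
    unfolding h_def by measurable
  have "emeasure M {\<omega> \<in> space M. norm (z \<omega>) \<le> r \<and> d \<le> z \<omega> \<bullet> u}
      = (\<integral>\<^sup>+x. ennreal (G (norm x)) * indicator (cball 0 r \<inter> {x. d \<le> x \<bullet> u}) x \<partial>lborel)"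
    using distributed_emeasure[OF noise, of "cball 0 r \<inter> {x. d \<le> x \<bullet> u}"]
    by (simp add: g_G Int_def conj_commute vimage_def)
  also have "\<dots> \<le> (\<integral>\<^sup>+x. ennreal (G (norm x) * cap_bound CARD('n) d (norm x)) * indicator (shell d r) x
                         \<partial>(lborel :: (real^'n) measure))"
    using G u \<open>0 < d\<close> \<open>d \<le> r\<close> by (rule nn_integral_cball_Int_halfspace_le)
  also have "\<dots> = (\<integral>\<^sup>+x. ennreal (g (norm x)) * h (norm x) \<partial>(lborel :: (real^'n) measure))"
    using G(1) by (intro nn_integral_cong)
      (auto simp: g_G h_def indicator_shell ennreal_mult cap_bound_nonneg indicator_def shell_def)
  also have "\<dots> = (\<integral>\<^sup>+\<omega>. h (norm (z \<omega>)) \<partial>M)"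
    by (rule distributed_nn_integral[OF noise]) measurable
  also have "\<dots> = (\<integral>\<^sup>+\<rho>. ennreal (f \<rho>) * h \<rho> \<partial>lborel)"
    by (rule distributed_nn_integral[OF f_dens, symmetric]) measurable
  finally show ?thesis
    unfolding h_def .
qed

lemma prob_cball_Int_halfspace_le:
  fixes M :: "'a measure" and z :: "'a \<Rightarrow> real^'n" and g f :: "real \<Rightarrow> real" and u :: "real^'n"
  assumes prob: "prob_space M"
    and noise: "distributed M lborel z (\<lambda>x. ennreal (g (norm x)))"
    and g_noninc: "\<forall>s t. 0 \<le> s \<longrightarrow> s \<le> t \<longrightarrow> g t \<le> g s"
    and f_dens: "distributed M lborel (\<lambda>\<omega>. norm (z \<omega>)) (\<lambda>\<rho>. ennreal (f \<rho>))"
    and f_nonneg: "\<forall>\<rho>. 0 \<le> f \<rho>"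
    and u: "norm u = 1" and "0 < d" "d \<le> r"
  shows "measure M {\<omega> \<in> space M. norm (z \<omega>) \<le> r \<and> d \<le> z \<omega> \<bullet> u}
     \<le> (LINT \<rho>:{d..r}|lborel. f \<rho> * cap_bound CARD('n) d \<rho>)"
proof -
  interpret prob_space M by fact
  let ?c = "cap_bound CARD('n) d"
  have c: "\<rho> \<in> {d..r} \<Longrightarrow> 0 \<le> ?c \<rho> \<and> ?c \<rho> \<le> 1" for \<rho>
    using cap_bound_le_1[OF \<open>0 < d\<close>] by (simp add: cap_bound_nonneg Suc_leI)
  note weighted = set_integral_weighted_density[where A = "{d..r}",
      OF integrable_density_of_distributed[OF prob f_dens f_nonneg] f_nonneg[rule_format]
      borel_measurable_cap_bound c]
  have "emeasure M {\<omega> \<in> space M. norm (z \<omega>) \<le> r \<and> d \<le> z \<omega> \<bullet> u}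
      \<le> (\<integral>\<^sup>+\<rho>. ennreal (f \<rho>) * (ennreal (?c \<rho>) * indicator {d<..r} \<rho>) \<partial>lborel)"
    using noise g_noninc f_dens u \<open>0 < d\<close> \<open>d \<le> r\<close> by (rule emeasure_cball_Int_halfspace_le)
  also have "\<dots> \<le> (\<integral>\<^sup>+\<rho>. ennreal (indicator {d..r} \<rho> * (f \<rho> * ?c \<rho>)) \<partial>lborel)"
    using f_nonneg
    by (intro nn_integral_mono) (auto simp: indicator_def ennreal_mult' simp del: ennreal_mult)
  also have "\<dots> = ennreal (LINT \<rho>:{d..r}|lborel. f \<rho> * ?c \<rho>)"
    using weighted(1) by simp
  finally show ?thesis
    using weighted(2) by (simp add: emeasure_eq_measure)
qed

section \<open>Lattices and their distance series\<close>

lemma finite_lattice_points_norm_le: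
  fixes L :: "(real^'n) set"
  assumes "is_lattice L"
  shows "finite {v \<in> L. norm v \<le> R}"
proof -
  obtain B :: "real^'n^'n" where "invertible B"
    and L: "L = range (\<lambda>k :: int^'n. B *v (\<chi> i. real_of_int (k $ i)))"
    using assms unfolding is_lattice_def by blast
  then obtain B' where B': "B' ** B = mat 1"
    unfolding invertible_def by blast
  obtain C where C: "0 < C" "\<And>x. norm (B' *v x) \<le> C * norm x"
    using linear_bounded_pos[OF matrix_vector_mul_linear[of B']] by blast
  define m where "m = \<lceil>C * R\<rceil>"
  define K where "K = {k :: int^'n. \<forall>i. \<bar>k $ i\<bar> \<le> m}"
  have "K \<subseteq> vec_lambda ` (PiE UNIV (\<lambda>_. {-m..m}))"
  proof
    fix k assume "k \<in> K"
    then have "(\<lambda>i. k $ i) \<in> PiE UNIV (\<lambda>_. {-m..m})"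
      unfolding K_def by (simp add: PiE_iff abs_le_iff minus_le_iff)
    then show "k \<in> vec_lambda ` (PiE UNIV (\<lambda>_. {-m..m}))"
      by (metis image_eqI vec_lambda_eta)
  qed
  then have "finite K"
    by (rule finite_subset) (intro finite_imageI finite_PiE; simp)
  moreover have "{v \<in> L. norm v \<le> R} \<subseteq> (\<lambda>k. B *v (\<chi> i. real_of_int (k $ i))) ` K"
  proof
    fix v assume v: "v \<in> {v \<in> L. norm v \<le> R}"
    then obtain k where k: "v = B *v (\<chi> i. real_of_int (k $ i))"
      using L by auto
    have "(\<chi> i. real_of_int (k $ i)) = B' *v v"
      unfolding k by (simp add: matrix_vector_mul_assoc B')
    then have "norm (\<chi> i. real_of_int (k $ i)) \<le> C * R"
      using C(2)[of v] v C(1) by (smt (verit) mem_Collect_eq mult_left_mono)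
    then have "real_of_int \<bar>k $ i\<bar> \<le> C * R" for i
      using component_le_norm_cart[of "\<chi> i. real_of_int (k $ i)" i] by simp
    then have "\<bar>k $ i\<bar> \<le> m" for i
      unfolding m_def by (metis ceiling_mono ceiling_of_int)
    then have "k \<in> K"
      unfolding K_def by blast
    then show "v \<in> (\<lambda>k. B *v (\<chi> i. real_of_int (k $ i))) ` K"
      using k by blast
  qed
  ultimately show ?thesis
    by (meson finite_imageI finite_subset)
qed

lemma lattice_exists_norm_gt:
  fixes L :: "(real^'n) set"
  assumes "is_lattice L"
  obtains v where "v \<in> L" "v \<noteq> 0" "a < norm v"
proof -
  obtain B :: "real^'n^'n" where "invertible B"
    and L: "L = range (\<lambda>k :: int^'n. B *v (\<chi> i. real_of_int (k $ i)))"
    using assms unfolding is_lattice_def by blast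
  then obtain B' where B': "B' ** B = mat 1"
    unfolding invertible_def by blast
  define w where "w = B *v (\<chi> i. 1)"
  have "B' *v w = (\<chi> i. 1)"
    by (simp add: w_def matrix_vector_mul_assoc B')
  then have "w \<noteq> 0"
    by (metis matrix_vector_mult_0_right one_neq_zero vec_lambda_beta zero_index)
  define m :: int where "m = \<lceil>\<bar>a\<bar> / norm w\<rceil> + 1"
  have "\<bar>a\<bar> / norm w \<le> of_int \<lceil>\<bar>a\<bar> / norm w\<rceil>" "0 \<le> \<bar>a\<bar> / norm w"
    by (simp_all add: le_of_int_ceiling)
  then have m: "\<bar>a\<bar> / norm w < of_int m" "1 \<le> m"
    unfolding m_def by linarith+
  define v where "v = B *v (\<chi> i. real_of_int ((\<chi> i. m) $ i))"
  have "v = real_of_int m *\<^sub>R w"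
    by (simp add: v_def w_def vec_eq_iff matrix_vector_mult_def sum_distrib_left algebra_simps)
  then have "\<bar>a\<bar> < norm v"
    using m \<open>w \<noteq> 0\<close> by (simp add: divide_less_eq)
  show ?thesis
  proof (rule that)
    show "v \<in> L"
      unfolding L v_def by blast
    show "v \<noteq> 0" "a < norm v"
      using \<open>\<bar>a\<bar> < norm v\<close> by auto
  qed
qed

lemma Inf_in_and_le_if_locally_finite:
  fixes X :: "real set"
  assumes fin: "\<And>R. finite (X \<inter> {..R})" and "X \<noteq> {}"
  shows "Inf X \<in> X" "\<And>x. x \<in> X \<Longrightarrow> Inf X \<le> x"
proof -
  obtain x0 where x0: "x0 \<in> X"
    using \<open>X \<noteq> {}\<close> by blast
  define m where "m = Min (X \<inter> {..x0})"
  have m: "m \<in> X" "m \<le> x0"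
    using Min_in[OF fin, of x0] x0 by (auto simp: m_def)
  have le: "m \<le> x" if "x \<in> X" for x
  proof (cases "x \<le> x0")
    case True
    then show ?thesis
      unfolding m_def using fin that by (intro Min_le) auto
  qed (use m(2) in simp)
  have "Inf X = m"
    by (intro cInf_eq_minimum m(1) le)
  then show "Inf X \<in> X" "\<And>x. x \<in> X \<Longrightarrow> Inf X \<le> x"
    using m(1) le by simp_all
qed

context
  fixes L :: "(real^'n) set"
  assumes lat: "is_lattice L"
begin

lemma finite_lattice_norms_le: "finite (lattice_norms L \<inter> {..R})"
proof -
  have "lattice_norms L \<inter> {..R} \<subseteq> norm ` {v \<in> L. norm v \<le> R}"
    unfolding lattice_norms_def by auto
  then show ?thesis
    using finite_lattice_points_norm_le[OF lat] by (meson finite_imageI finite_subset)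
qed

lemma lattice_norms_pos: "d \<in> lattice_norms L \<Longrightarrow> 0 < d"
  unfolding lattice_norms_def by auto

lemma lattice_dist_Suc:
  shows "lattice_dist L (Suc j) \<in> lattice_norms L"
    and "lattice_dist L j < lattice_dist L (Suc j)"
    and "\<And>d. d \<in> lattice_norms L \<Longrightarrow> lattice_dist L j < d \<Longrightarrow> lattice_dist L (Suc j) \<le> d"
proof -
  define T where "T = {d \<in> lattice_norms L. lattice_dist L j < d}"
  have fin: "finite (T \<inter> {..R})" for R
    using finite_lattice_norms_le[of R] unfolding T_def by (rule finite_subset[rotated]) auto
  obtain v where "v \<in> L" "v \<noteq> 0" "lattice_dist L j < norm v"
    using lattice_exists_norm_gt[OF lat] .
  then have "T \<noteq> {}"
    unfolding T_def lattice_norms_def by auto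
  moreover have "lattice_dist L (Suc j) = Inf T"
    unfolding T_def by simp
  ultimately show "lattice_dist L (Suc j) \<in> lattice_norms L"
    and "lattice_dist L j < lattice_dist L (Suc j)"
    and "\<And>d. d \<in> lattice_norms L \<Longrightarrow> lattice_dist L j < d \<Longrightarrow> lattice_dist L (Suc j) \<le> d"
    using Inf_in_and_le_if_locally_finite[OF fin] unfolding T_def by auto
qed

lemma strict_mono_lattice_dist: "strict_mono (lattice_dist L)"
  using lattice_dist_Suc(2) by (simp add: strict_mono_Suc_iff)

lemma lattice_dist_in_norms: "1 \<le> j \<Longrightarrow> lattice_dist L j \<in> lattice_norms L"
  using lattice_dist_Suc(1)[of "j - 1"] by (cases j) auto

lemma lattice_dist_pos: "1 \<le> j \<Longrightarrow> 0 < lattice_dist L j"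
  using lattice_dist_in_norms lattice_norms_pos by blast

lemma finite_lattice_dist_le: "finite {j. lattice_dist L j \<le> R}"
proof -
  have "lattice_dist L ` {j. lattice_dist L j \<le> R} \<subseteq> insert 0 (lattice_norms L \<inter> {..R})"
  proof
    fix x assume "x \<in> lattice_dist L ` {j. lattice_dist L j \<le> R}"
    then obtain j where "x = lattice_dist L j" "x \<le> R"
      by auto
    then show "x \<in> insert 0 (lattice_norms L \<inter> {..R})"
      using lattice_dist_in_norms[of j] by (cases j) auto
  qed
  then have "finite (lattice_dist L ` {j. lattice_dist L j \<le> R})"
    using finite_lattice_norms_le[of R] by (meson finite_insert finite_subset)
  then show ?thesis
    using strict_mono_imp_inj_on[OF strict_mono_lattice_dist] by (simp add: finite_image_iff)
qed

lemma lattice_norm_eq_lattice_dist: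
  assumes d: "d \<in> lattice_norms L"
  shows "\<exists>j\<ge>1. lattice_dist L j = d"
proof -
  define P where "P = {j. lattice_dist L j < d}"
  have "finite P"
    using finite_lattice_dist_le[of d] by (rule finite_subset[rotated]) (auto simp: P_def)
  have "0 \<in> P"
    using lattice_norms_pos[OF d] by (simp add: P_def)
  then have "Max P \<in> P"
    using \<open>finite P\<close> by (intro Max_in) auto
  have "Suc (Max P) \<notin> P"
    using \<open>finite P\<close> by (metis Max_ge Suc_n_not_le_n)
  then have "d \<le> lattice_dist L (Suc (Max P))"
    by (simp add: P_def)
  moreover have "lattice_dist L (Suc (Max P)) \<le> d"
    using lattice_dist_Suc(3)[OF d] \<open>Max P \<in> P\<close> by (simp add: P_def)
  ultimately show ?thesis
    by (intro exI[of _ "Suc (Max P)"]) auto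
qed

lemma mem_lattice_M_iff: "j \<in> {1..lattice_M L r} \<longleftrightarrow> 1 \<le> j \<and> lattice_dist L j \<le> 2 * r"
proof -
  define J where "J = {j. 1 \<le> j \<and> lattice_dist L j \<le> 2 * r}"
  have "finite J"
    using finite_lattice_dist_le[of "2 * r"] by (rule finite_subset[rotated]) (auto simp: J_def)
  have M: "lattice_M L r = Max (insert 0 J)"
    unfolding lattice_M_def J_def by simp
  show ?thesis
  proof
    assume j: "j \<in> {1..lattice_M L r}"
    then have "J \<noteq> {}"
      using M by (cases "J = {}") auto
    then have "Max J \<in> J"
      using \<open>finite J\<close> by (intro Max_in)
    moreover have "Max (insert 0 J) = Max J"
      using \<open>finite J\<close> \<open>J \<noteq> {}\<close> by (simp add: Max_insert max_def)
    ultimately have "lattice_M L r \<in> J"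
      using M by simp
    moreover have "lattice_dist L j \<le> lattice_dist L (lattice_M L r)"
      using j strict_mono_lattice_dist by (simp add: strict_mono_less_eq)
    ultimately show "1 \<le> j \<and> lattice_dist L j \<le> 2 * r"
      using j unfolding J_def by auto
  next
    assume "1 \<le> j \<and> lattice_dist L j \<le> 2 * r"
    then have "j \<in> J" "1 \<le> j"
      by (simp_all add: J_def)
    then show "j \<in> {1..lattice_M L r}"
      using M \<open>finite J\<close> by simp
  qed
qed

lemma sum_short_vectors_eq_sum_lattice_dist:
  fixes F :: "real \<Rightarrow> real"
  shows "(\<Sum>v\<in>{v \<in> L. v \<noteq> 0 \<and> norm v \<le> 2 * r}. F (norm v))
       = (\<Sum>j = 1..lattice_M L r. real (lattice_mult L j) * F (lattice_dist L j))"
proof -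
  define W where "W j = {v \<in> L. norm v = lattice_dist L j}" for j
  have fin: "finite (W j)" for j
    using finite_lattice_points_norm_le[OF lat, of "lattice_dist L j"]
    unfolding W_def by (rule finite_subset[rotated]) auto
  have disj: "W i \<inter> W j = {}" if "i \<noteq> j" for i j
    using that strict_mono_lattice_dist strict_mono_eq unfolding W_def by fastforce
  have V: "{v \<in> L. v \<noteq> 0 \<and> norm v \<le> 2 * r} = (\<Union>j\<in>{1..lattice_M L r}. W j)"
  proof (intro equalityI subsetI)
    fix v assume v: "v \<in> {v \<in> L. v \<noteq> 0 \<and> norm v \<le> 2 * r}"
    then obtain j where j: "1 \<le> j" "lattice_dist L j = norm v"
      using lattice_norm_eq_lattice_dist[of "norm v"] by (auto simp: lattice_norms_def)
    then have "j \<in> {1..lattice_M L r}" "v \<in> W j"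
      using v unfolding mem_lattice_M_iff by (simp_all add: W_def)
    then show "v \<in> (\<Union>j\<in>{1..lattice_M L r}. W j)"
      by blast
  next
    fix v assume "v \<in> (\<Union>j\<in>{1..lattice_M L r}. W j)"
    then obtain j where j: "j \<in> {1..lattice_M L r}" "v \<in> W j"
      by auto
    then have "0 < lattice_dist L j" "lattice_dist L j \<le> 2 * r"
      using lattice_dist_pos unfolding mem_lattice_M_iff by auto
    then show "v \<in> {v \<in> L. v \<noteq> 0 \<and> norm v \<le> 2 * r}"
      using j(2) unfolding W_def by auto
  qed
  have "(\<Sum>v\<in>(\<Union>j\<in>{1..lattice_M L r}. W j). F (norm v)) = (\<Sum>j = 1..lattice_M L r. \<Sum>v\<in>W j. F (norm v))"
    using fin disj by (intro sum.UNION_disjoint) auto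
  also have "\<dots> = (\<Sum>j = 1..lattice_M L r. real (lattice_mult L j) * F (lattice_dist L j))"
    by (intro sum.cong refl) (simp add: W_def lattice_mult_def)
  finally show ?thesis
    unfolding V .
qed

end

section \<open>The error probability\<close>

lemma closer_point_bounds:
  fixes y v :: "'a::real_inner"
  assumes "norm (y - v) \<le> norm y" and "v \<noteq> 0"
  shows "norm v \<le> 2 * norm y" and "norm v / 2 \<le> y \<bullet> (v /\<^sub>R norm v)"
proof -
  show "norm v \<le> 2 * norm y"
    using norm_triangle_ineq4[of y "y - v"] assms(1) by simp
  have "(y - v) \<bullet> (y - v) \<le> y \<bullet> y"
    using assms(1) by (simp add: dot_square_norm power_mono)
  then have "v \<bullet> v \<le> 2 * (y \<bullet> v)"
    by (simp add: inner_diff_left inner_diff_right inner_commute)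
  then have "norm v * norm v \<le> 2 * (y \<bullet> v)"
    by (simp add: dot_square_norm power2_eq_square)
  then show "norm v / 2 \<le> y \<bullet> (v /\<^sub>R norm v)"
    using assms(2) by (simp add: field_simps inner_commute)
qed

lemma measure_not_in_voronoi0_le:
  fixes L :: "(real^'n) set" and z :: "'a \<Rightarrow> real^'n"
  assumes "prob_space M" and z: "z \<in> borel_measurable M"
    and fin: "finite {v \<in> L. v \<noteq> 0 \<and> norm v \<le> 2 * r}"
  shows "measure M {\<omega> \<in> space M. z \<omega> \<notin> voronoi0 L}
     \<le> measure M {\<omega> \<in> space M. r < norm (z \<omega>)}
       + (\<Sum>v\<in>{v \<in> L. v \<noteq> 0 \<and> norm v \<le> 2 * r}.
            measure M {\<omega> \<in> space M. norm (z \<omega>) \<le> r \<and> norm v / 2 \<le> z \<omega> \<bullet> (v /\<^sub>R norm v)})"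
proof -
  interpret prob_space M by fact
  define V where "V = {v \<in> L. v \<noteq> 0 \<and> norm v \<le> 2 * r}"
  define E where "E v = {\<omega> \<in> space M. norm (z \<omega>) \<le> r \<and> norm v / 2 \<le> z \<omega> \<bullet> (v /\<^sub>R norm v)}" for v
  let ?E0 = "{\<omega> \<in> space M. r < norm (z \<omega>)}"
  have E0: "?E0 \<in> sets M" and E: "E v \<in> sets M" for v
    using z by (auto simp: E_def)
  have "(\<Union>v\<in>V. E v) \<in> sets M"
    using fin E by (auto simp: V_def)
  have "{\<omega> \<in> space M. z \<omega> \<notin> voronoi0 L} \<subseteq> ?E0 \<union> (\<Union>v\<in>V. E v)"
  proof
    fix \<omega> assume \<omega>: "\<omega> \<in> {\<omega> \<in> space M. z \<omega> \<notin> voronoi0 L}"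
    then obtain v where v: "v \<in> L" "v \<noteq> 0" "norm (z \<omega> - v) \<le> norm (z \<omega>)"
      by (auto simp: voronoi0_def not_less)
    show "\<omega> \<in> ?E0 \<union> (\<Union>v\<in>V. E v)"
    proof (cases "r < norm (z \<omega>)")
      case False
      then have "v \<in> V" "\<omega> \<in> E v"
        using \<omega> v closer_point_bounds[OF v(3) v(2)] by (auto simp: V_def E_def)
      then show ?thesis
        by blast
    qed (use \<omega> in auto)
  qed
  then have "measure M {\<omega> \<in> space M. z \<omega> \<notin> voronoi0 L} \<le> measure M (?E0 \<union> (\<Union>v\<in>V. E v))"
    using E0 \<open>(\<Union>v\<in>V. E v) \<in> sets M\<close> by (intro finite_measure_mono) auto
  also have "\<dots> \<le> measure M ?E0 + measure M (\<Union>v\<in>V. E v)"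
    using E0 \<open>(\<Union>v\<in>V. E v) \<in> sets M\<close> by (rule measure_Un_le)
  also have "measure M (\<Union>v\<in>V. E v) \<le> (\<Sum>v\<in>V. measure M (E v))"
    using fin E by (intro finite_measure_subadditive_finite) (auto simp: V_def)
  finally show ?thesis
    by (simp add: V_def E_def)
qed

text \<open>The bound holds for every \<open>r\<close>.\<close>

theorem theorem7:
  fixes L :: "(real^'n) set" and M :: "'a measure" and z :: "'a \<Rightarrow> real^'n"
    and g f :: "real \<Rightarrow> real" and r :: real
  assumes lat: "is_lattice L"
    and prob: "prob_space M"
    and noise: "distributed M lborel z (\<lambda>x. ennreal (g (norm x)))"
    and g_noninc: "\<forall>s t. 0 \<le> s \<longrightarrow> s \<le> t \<longrightarrow> g t \<le> g s"
    and f_dens: "distributed M lborel (\<lambda>\<omega>. norm (z \<omega>)) (\<lambda>\<rho>. ennreal (f \<rho>))"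
    and f_nonneg: "\<forall>\<rho>. 0 \<le> f \<rho>"
    and r_pos: "r > 0"
  shows "measure M {\<omega> \<in> space M. z \<omega> \<notin> voronoi0 L}
     \<le> (\<Sum>j = 1..lattice_M L r.
           real (lattice_mult L j) *
           (LINT \<rho>:{lattice_dist L j / 2..r}|lborel.
              f \<rho> * (1 - (lattice_dist L j / (2 * \<rho>))^2) powr ((real CARD('n) - 1) / 2)))
       + (LINT \<rho>:{r<..}|lborel. f \<rho>)"
proof -
  define I where "I l = (LINT \<rho>:{l / 2..r}|lborel. f \<rho> * cap_bound CARD('n) (l / 2) \<rho>)" for l
  let ?V = "{v \<in> L. v \<noteq> 0 \<and> norm v \<le> 2 * r}"
  have "finite ?V"
    using finite_lattice_points_norm_le[OF lat, of "2 * r"] by (rule finite_subset[rotated]) auto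
  have "z \<in> borel_measurable M"
    using distributed_measurable[OF noise] by simp
  then have "measure M {\<omega> \<in> space M. z \<omega> \<notin> voronoi0 L}
      \<le> measure M {\<omega> \<in> space M. r < norm (z \<omega>)}
        + (\<Sum>v\<in>?V. measure M {\<omega> \<in> space M. norm (z \<omega>) \<le> r \<and> norm v / 2 \<le> z \<omega> \<bullet> (v /\<^sub>R norm v)})"
    by (rule measure_not_in_voronoi0_le[OF prob _ \<open>finite ?V\<close>])
  also have "\<dots> \<le> measure M ((\<lambda>\<omega>. norm (z \<omega>)) -` {r<..} \<inter> space M) + (\<Sum>v\<in>?V. I (norm v))"
    unfolding I_def
    by (intro add_mono sum_mono prob_cball_Int_halfspace_le[OF prob noise g_noninc f_dens f_nonneg])
      (auto simp: Int_def conj_commute)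
  also have "\<dots> = (LINT \<rho>:{r<..}|lborel. f \<rho>)
                   + (\<Sum>j = 1..lattice_M L r. real (lattice_mult L j) * I (lattice_dist L j))"
    by (simp add: measure_distributed_eq_set_integral[OF prob f_dens f_nonneg]
        sum_short_vectors_eq_sum_lattice_dist[OF lat])
  finally show ?thesis
    by (simp add: I_def cap_bound_def add.commute)
qed

end
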